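(* Let $G=(V,E)$ be an undirected graph with positive edge weights $w$, let $VC\subseteq V$ be a vertex cover of $G$ and $X=V\setminus VC$. Then for every $S\subseteq VC$, $$\tfrac12\,\Delta_G(S)\le \Delta_{G_{VC}}(S)\le \Delta_G(S).$$
   Context: $X$ is an independent set. For $x\in X$ with neighborhood $N(x)\subseteq VC$ and $S\subseteq VC$, let $w(x,S)=\sum_{u\in S\cap N(x)}w(x,u)$ and $w^{(x)}(S)=\min\{w(x,S),w(x,VC\setminus S)\}$. Let $G\setminus X$ denote the subgraph of $G$ induced on $VC$, and for a graph $F$ on $VC$ let $\Delta_F(S)$ be the total weight of edges of $F$ with exactly one endpoint in $S$. Define $\Delta_G(S):=\Delta_{G\setminus X}(S)+\sum_{x\in X}w^{(x)}(S)$ (the weight of the cheapest cut of $G$ whose restriction to $VC$ is $S$). For $x\in X$ let $K_x$ be the clique on $N(x)$ in which each pair $u,v\in N(x)$ is joined by an edge of weight $\frac{w(x,u)\,w(x,v)}{\sum_{i\in N(x)}w(x,i)}$. Let $G_{VC}$ be the multigraph on $VC$ given by $(G\setminus X)\cup\bigcup_{x\in X}K_x$, and $\Delta_{G_{VC}}(S)$ the total weight of its edges with exactly one endpoint in $S$. *)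

theory Defs
  imports Complex_Main "HOL-Library.Multiset" "HOL-Library.Ramsey"
begin

text \<open>A graph is given by a vertex set \<open>V\<close>, a set \<open>E\<close> of two-element subsets of \<open>V\<close>, and
  a weight function on edges; \<open>w {x, u}\<close> is the weight written $w(x,u)$ in the mathematics.\<close>

definition weighted_graph :: "'a set \<Rightarrow> 'a set set \<Rightarrow> ('a set \<Rightarrow> real) \<Rightarrow> bool" where
  "weighted_graph V E w \<longleftrightarrow> finite V \<and> E \<subseteq> [V]\<^bsup>2\<^esup> \<and> (\<forall>e\<in>E. w e > 0)"

definition vertex_cover :: "'a set \<Rightarrow> 'a set set \<Rightarrow> 'a set \<Rightarrow> bool" where
  "vertex_cover V E VC \<longleftrightarrow> VC \<subseteq> V \<and> (\<forall>e\<in>E. e \<inter> VC \<noteq> {})"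

definition neighborhood :: "'a set set \<Rightarrow> 'a \<Rightarrow> 'a set" where
  "neighborhood E x = {u. {x, u} \<in> E}"

text \<open>A weighted multigraph is the multiset of its edges, each paired with its weight, so that
  the multiset sum is the union that keeps parallel edges.\<close>

type_synonym 'a wmultigraph = "('a set \<times> real) multiset"

definition weighted_edges :: "'a set set \<Rightarrow> ('a set \<Rightarrow> real) \<Rightarrow> 'a wmultigraph" where
  "weighted_edges E w = image_mset (\<lambda>e. (e, w e)) (mset_set E)"

definition cut_weight :: "'a wmultigraph \<Rightarrow> 'a set \<Rightarrow> real" where
  "cut_weight F S = (\<Sum>(e, c) \<in># filter_mset (\<lambda>(e, c). card (e \<inter> S) = 1) F. c)"

definition induced :: "'a set set \<Rightarrow> ('a set \<Rightarrow> real) \<Rightarrow> 'a set \<Rightarrow> 'a wmultigraph" where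
  "induced E w U = weighted_edges {e \<in> E. e \<subseteq> U} w"

definition weight_to :: "'a set set \<Rightarrow> ('a set \<Rightarrow> real) \<Rightarrow> 'a \<Rightarrow> 'a set \<Rightarrow> real" where
  "weight_to E w x S = (\<Sum>u \<in> S \<inter> neighborhood E x. w {x, u})"

definition min_side ::
  "'a set set \<Rightarrow> ('a set \<Rightarrow> real) \<Rightarrow> 'a set \<Rightarrow> 'a \<Rightarrow> 'a set \<Rightarrow> real" where
  "min_side E w VC x S = min (weight_to E w x S) (weight_to E w x (VC - S))"

text \<open>\<open>Delta_G V E w VC S\<close> is $\Delta_G(S)$, where $X$ is \<open>V - VC\<close>.\<close>

definition Delta_G ::
  "'a set \<Rightarrow> 'a set set \<Rightarrow> ('a set \<Rightarrow> real) \<Rightarrow> 'a set \<Rightarrow> 'a set \<Rightarrow> real" where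
  "Delta_G V E w VC S = cut_weight (induced E w VC) S + (\<Sum>x \<in> V - VC. min_side E w VC x S)"

text \<open>For an edge $\{u,v\}$ of the clique $K_x$ the product below is $w(x,u)\,w(x,v)$.\<close>

definition star_clique :: "'a set set \<Rightarrow> ('a set \<Rightarrow> real) \<Rightarrow> 'a \<Rightarrow> 'a wmultigraph" where
  "star_clique E w x = weighted_edges ([neighborhood E x]\<^bsup>2\<^esup>)
     (\<lambda>e. (\<Prod>u\<in>e. w {x, u}) / (\<Sum>i \<in> neighborhood E x. w {x, i}))"

definition G_VC ::
  "'a set \<Rightarrow> 'a set set \<Rightarrow> ('a set \<Rightarrow> real) \<Rightarrow> 'a set \<Rightarrow> 'a wmultigraph" where
  "G_VC V E w VC = induced E w VC + (\<Sum>x \<in> V - VC. star_clique E w x)"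

lemma vertex_cover_indep:
  assumes "vertex_cover V E VC"
  shows "indep (V - VC) E"
  using assms unfolding vertex_cover_def indep_def by fastforce

lemma neighborhood_subset_cover:
  assumes "vertex_cover V E VC" "x \<in> V - VC"
  shows "neighborhood E x \<subseteq> VC"
  using assms unfolding vertex_cover_def neighborhood_def by fastforce

lemma star_clique_weight:
  "u \<noteq> v \<Longrightarrow> (\<Prod>z\<in>{u, v}. w {x, z}) = w {x, u} * (w {x, v} :: real)"
  by simp

end

theory Submission
  imports Defs
begin

text \<open>Let \<open>a\<close> and \<open>b\<close> be the total weights from \<open>x\<close> to \<open>S\<close> and to \<open>VC - S\<close>. The edges of the
  clique \<open>K_x\<close> cut by \<open>S\<close> are the pairs with one end on each side, so they have total weight
  \<open>a * b / (a + b)\<close>. This is \<open>min a b\<close> times the fraction \<open>max a b / (a + b)\<close>, which lies between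
  \<open>1/2\<close> and \<open>1\<close>. Edges inside \<open>VC\<close> contribute equally to both sides.\<close>

lemma cut_weight_add: "cut_weight (F + F') S = cut_weight F S + cut_weight F' S"
  by (simp add: cut_weight_def)

lemma cut_weight_sum: "cut_weight (\<Sum>x\<in>A. F x) S = (\<Sum>x\<in>A. cut_weight (F x) S)"
proof -
  \<comment> \<open>An empty index set, and by convention an infinite one, makes the inner sum the
    empty multigraph.\<close>
  have "cut_weight {#} S = 0" by (simp add: cut_weight_def)
  then show ?thesis
    by (induction A rule: infinite_finite_induct) (auto simp: cut_weight_add)
qed

lemma cut_weight_weighted_edges:
  assumes "finite E"
  shows "cut_weight (weighted_edges E w) S = (\<Sum>e\<in>{e \<in> E. card (e \<inter> S) = 1}. w e)"
  using assms
  by (simp add: cut_weight_def weighted_edges_def filter_mset_image_mset sum_unfold_sum_mset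
      image_mset.compositionality comp_def)

text \<open>Listing the end in \<open>S\<close> first orders the two ends of a crossing edge in
  exactly one way. Sums over crossing edges thus become sums over a product set, which can be
  factored.\<close>

lemma bij_betw_crossing_pairs:
  "bij_betw (\<lambda>(u, v). {u, v}) ((N \<inter> S) \<times> (N - S)) {e \<in> [N]\<^bsup>2\<^esup>. card (e \<inter> S) = 1}"
proof (rule bij_betw_imageI)
  show "inj_on (\<lambda>(u, v). {u, v}) ((N \<inter> S) \<times> (N - S))"
    by (auto simp: inj_on_def doubleton_eq_iff)
  show "(\<lambda>(u, v). {u, v}) ` ((N \<inter> S) \<times> (N - S)) = {e \<in> [N]\<^bsup>2\<^esup>. card (e \<inter> S) = 1}"
  proof (intro equalityI subsetI)
    fix e assume "e \<in> (\<lambda>(u, v). {u, v}) ` ((N \<inter> S) \<times> (N - S))"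
    then obtain u v where "u \<in> N" "u \<in> S" "v \<in> N" "v \<notin> S" "e = {u, v}" by auto
    moreover from this have "e \<inter> S = {u}" "u \<noteq> v" by auto
    ultimately show "e \<in> {e \<in> [N]\<^bsup>2\<^esup>. card (e \<inter> S) = 1}" by (simp add: nsets_def)
  next
    fix e assume e: "e \<in> {e \<in> [N]\<^bsup>2\<^esup>. card (e \<inter> S) = 1}"
    then have sub: "e \<subseteq> N" and card: "card e = 2" and "card (e \<inter> S) = 1"
      by (auto simp: nsets_def)
    then obtain u where u: "e \<inter> S = {u}" by (auto simp: card_1_singleton_iff)
    have "u \<in> e" using u by auto
    with card obtain v where v: "e = {u, v}" "v \<noteq> u"
      by (auto simp: card_2_iff)
    with u have "v \<notin> S" by auto
    with u v sub have "(u, v) \<in> (N \<inter> S) \<times> (N - S)" by auto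
    then show "e \<in> (\<lambda>(u, v). {u, v}) ` ((N \<inter> S) \<times> (N - S))" using v by force
  qed
qed

lemma cut_weight_star_clique:
  fixes w :: "'a set \<Rightarrow> real" and S :: "'a set"
  assumes fin: "finite (neighborhood E x)" and sub: "neighborhood E x \<subseteq> VC"
  defines "a \<equiv> weight_to E w x S" and "b \<equiv> weight_to E w x (VC - S)"
  shows "cut_weight (star_clique E w x) S = a * b / (a + b)"
proof -
  define N where "N = neighborhood E x"
  have N: "finite N" using fin by (simp add: N_def)
  have a: "a = (\<Sum>u\<in>N \<inter> S. w {x, u})" by (simp add: a_def weight_to_def N_def Int_commute)
  \<comment> \<open>As \<open>N\<close> lies in \<open>VC\<close>, the complement of
    \<open>S\<close> relative to \<open>VC\<close> cuts out the same part of \<open>N\<close> as the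
    full complement.\<close>
  have "(VC - S) \<inter> N = N - S" using sub by (auto simp: N_def)
  then have b: "b = (\<Sum>u\<in>N - S. w {x, u})" by (simp add: b_def weight_to_def N_def)
  have total: "(\<Sum>u\<in>N. w {x, u}) = a + b"
    unfolding a b using N by (rule sum.Int_Diff)
  have "cut_weight (star_clique E w x) S
      = (\<Sum>e\<in>{e \<in> [N]\<^bsup>2\<^esup>. card (e \<inter> S) = 1}. (\<Prod>u\<in>e. w {x, u}) / (a + b))"
    unfolding star_clique_def N_def[symmetric] total
    by (rule cut_weight_weighted_edges) (simp add: N finite_imp_finite_nsets)
  also have "\<dots> = (\<Sum>(u, v)\<in>(N \<inter> S) \<times> (N - S). (\<Prod>z\<in>{u, v}. w {x, z}) / (a + b))"
    by (subst sum.reindex_bij_betw[OF bij_betw_crossing_pairs, symmetric]) (simp add: case_prod_unfold)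
  also have "\<dots> = (\<Sum>(u, v)\<in>(N \<inter> S) \<times> (N - S). w {x, u} * w {x, v} / (a + b))"
  proof (intro sum.cong refl, clarify)
    \<comment> \<open>The ends lie on opposite sides of the cut, so they differ and the product over
      \<open>{u, v}\<close> really has two factors.\<close>
    fix u v assume "u \<in> S" "v \<notin> S"
    then have "u \<noteq> v" by auto
    then show "(\<Prod>z\<in>{u, v}. w {x, z}) / (a + b) = w {x, u} * w {x, v} / (a + b)"
      by simp
  qed
  also have "\<dots> = a * b / (a + b)"
    by (simp add: a b sum_product sum.cartesian_product sum_divide_distrib case_prod_unfold)
  finally show ?thesis .
qed

lemma parallel_sum_bounds:
  fixes a b :: real
  assumes "a \<ge> 0" "b \<ge> 0"
  shows "min a b / 2 \<le> a * b / (a + b)" "a * b / (a + b) \<le> min a b"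
proof -
  have "min a b / 2 \<le> a * b / (a + b) \<and> a * b / (a + b) \<le> min a b"
  proof (cases "a + b = 0")
    \<comment> \<open>This covers an \<open>x\<close> without neighbors: division by zero yields 0,
      and all three quantities vanish.\<close>
    case True
    with assms have "a = 0" "b = 0" by auto
    then show ?thesis by simp
  next
    case False
    with assms have pos: "a + b > 0" by simp
    have eq: "a * b = min a b * max a b" by (simp add: min_def max_def)
    \<comment> \<open>The larger of two numbers is at least half their sum; for nonnegative numbers
      it is also at most their sum.\<close>
    have "min a b * (a + b) \<le> min a b * (2 * max a b)"
      by (rule mult_left_mono) (use assms in auto)
    moreover have "min a b * max a b \<le> min a b * (a + b)"
      by (rule mult_left_mono) (use assms in auto)
    ultimately show ?thesis
      \<comment> \<open>Deleting \<open>min.bounded_iff\<close> keeps the upper bound by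
        \<open>min a b\<close> in one piece, so that clearing the denominator gives the product
        inequality above.\<close>
      unfolding eq using pos by (simp add: pos_le_divide_eq pos_divide_le_eq del: min.bounded_iff)
  qed
  then show "min a b / 2 \<le> a * b / (a + b)" "a * b / (a + b) \<le> min a b" by auto
qed

theorem theorem6p9:
  fixes V VC :: "'a set" and E :: "'a set set" and w :: "'a set \<Rightarrow> real"
  assumes "weighted_graph V E w"
    and "vertex_cover V E VC"
  shows "\<forall>S. S \<subseteq> VC \<longrightarrow>
    (1/2) * Delta_G V E w VC S \<le> cut_weight (G_VC V E w VC) S \<and>
    cut_weight (G_VC V E w VC) S \<le> Delta_G V E w VC S"
proof (intro allI impI)
  fix S
  have V: "finite V" and E: "E \<subseteq> [V]\<^bsup>2\<^esup>" and pos: "\<And>e. e \<in> E \<Longrightarrow> w e > 0"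
    using assms(1) by (auto simp: weighted_graph_def)
  have VC: "finite VC" using assms(2) V by (auto simp: vertex_cover_def intro: finite_subset)
  have "finite E" using E V finite_imp_finite_nsets finite_subset by blast
  \<comment> \<open>The lower bound halves the weight cut inside \<open>VC\<close>, while
    \<open>G_VC\<close> carries it in full; nonnegativity makes the half at most the whole.\<close>
  then have base: "cut_weight (induced E w VC) S \<ge> 0"
    by (auto simp: induced_def cut_weight_weighted_edges intro!: sum_nonneg dest: pos)
  have weight_nonneg: "weight_to E w x T \<ge> 0" for x T
    by (auto simp: weight_to_def neighborhood_def intro!: sum_nonneg dest: pos)
  have star: "min_side E w VC x S / 2 \<le> cut_weight (star_clique E w x) S"
    "cut_weight (star_clique E w x) S \<le> min_side E w VC x S" if "x \<in> V - VC" for x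
  proof -
    have sub: "neighborhood E x \<subseteq> VC"
      using neighborhood_subset_cover[OF assms(2) that] .
    have "finite (neighborhood E x)" using sub VC by (rule finite_subset)
    note cut = cut_weight_star_clique[OF this sub, of w S]
    show "min_side E w VC x S / 2 \<le> cut_weight (star_clique E w x) S"
      "cut_weight (star_clique E w x) S \<le> min_side E w VC x S"
      unfolding cut min_side_def by (intro parallel_sum_bounds weight_nonneg)+
  qed
  have "(\<Sum>x\<in>V - VC. min_side E w VC x S) / 2 \<le> (\<Sum>x\<in>V - VC. cut_weight (star_clique E w x) S)"
    unfolding sum_divide_distrib by (intro sum_mono star)
  moreover have "(\<Sum>x\<in>V - VC. cut_weight (star_clique E w x) S) \<le> (\<Sum>x\<in>V - VC. min_side E w VC x S)"
    by (intro sum_mono star)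
  ultimately show "(1/2) * Delta_G V E w VC S \<le> cut_weight (G_VC V E w VC) S \<and>
    cut_weight (G_VC V E w VC) S \<le> Delta_G V E w VC S"
    using base by (simp add: Delta_G_def G_VC_def cut_weight_add cut_weight_sum)
qed

end
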